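(* Let $G$ be a finite $d$-regular graph with vertex set $V$ and edge set $E$. Let $Z_1,\ldots,Z_m$ be independent random variables, let $W_i\subseteq V$ be given for each $i=1,\ldots,m$, and for each $v\in V$ let $X_v$ be a real-valued random variable that is a measurable function of those $Z_i$ for which $v\in W_i$. Let $$\beta=\frac12\left(d+\min_{1\le i\le m;\ W\subseteq W_i}\frac{|\partial W|}{|W|}\right).$$ If $\mathrm{var}(X_v)<\infty$ for each $v\in V$, then $$\left|\sum_{(u,v)\in E}\mathrm{cov}(X_u,X_v)\right|\ \le\ \sqrt{\beta(d-\beta)}\ \sum_{v\in V}\mathrm{var}(X_v).$$
   Context: $\partial W$ is the set of edges with exactly one endpoint in $W$. Each (unordered) edge is counted once in the sum over $E$. The minimum is over pairs $(i,W)$ with $W$ a nonempty subset of $W_i$; at least one $W_i$ is nonempty. The variables $X_v$ need not be discrete. *)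

theory Defs
  imports "HOL-Probability.Probability"
begin

text \<open>An edge is an unordered pair of distinct vertices, represented as a two-element set.\<close>

definition simple_graph :: "'v set \<Rightarrow> 'v set set \<Rightarrow> bool" where
  "simple_graph V E \<longleftrightarrow> (\<forall>e\<in>E. e \<subseteq> V \<and> card e = 2)"

definition regular_graph :: "nat \<Rightarrow> 'v set \<Rightarrow> 'v set set \<Rightarrow> bool" where
  "regular_graph d V E \<longleftrightarrow> simple_graph V E \<and> (\<forall>v\<in>V. card {e \<in> E. v \<in> e} = d)"

definition edge_boundary :: "'v set set \<Rightarrow> 'v set \<Rightarrow> 'v set set" where
  "edge_boundary E W = {e \<in> E. card (e \<inter> W) = 1}"

definition beta :: "nat \<Rightarrow> 'v set set \<Rightarrow> nat \<Rightarrow> (nat \<Rightarrow> 'v set) \<Rightarrow> real" where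
  "beta d E m W =
     (1/2) * (real d + Min {real (card (edge_boundary E U)) / real (card U) | i U.
                             i \<in> {1..m} \<and> U \<subseteq> W i \<and> U \<noteq> {}})"

text \<open>The value of a symmetric function of two vertices at an unordered edge; by the lemma
  below it does not depend on how the edge is written.\<close>

definition at_edge :: "('v \<Rightarrow> 'v \<Rightarrow> real) \<Rightarrow> 'v set \<Rightarrow> real" where
  "at_edge f e = (THE c. \<exists>u v. e = {u, v} \<and> c = f u v)"

lemma at_edge_doubleton:
  assumes "\<And>x y. f x y = f y x"
  shows "at_edge f {u, v} = f u v"
  unfolding at_edge_def
  by (rule the_equality) (auto simp: doubleton_eq_iff assms)

definition covariance :: "'a measure \<Rightarrow> ('a \<Rightarrow> real) \<Rightarrow> ('a \<Rightarrow> real) \<Rightarrow> real" where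
  "covariance M X Y =
     (\<integral>\<omega>. (X \<omega> - integral\<^sup>L M X) * (Y \<omega> - integral\<^sup>L M Y) \<partial>M)"

lemma covariance_commute: "covariance M X Y = covariance M Y X"
  by (simp add: covariance_def mult.commute)

lemma at_edge_covariance:
  "at_edge (\<lambda>u v. covariance M (X u) (X v)) {u, v} = covariance M (X u) (X v)"
  by (rule at_edge_doubleton) (rule covariance_commute)

text \<open>The library's variance of a function is a Bochner integral and hence 0 when that integral
  does not converge, so finiteness has to be stated through integrability.\<close>

definition finite_variance :: "'a measure \<Rightarrow> ('a \<Rightarrow> real) \<Rightarrow> bool" where
  "finite_variance M X \<longleftrightarrow>
     integrable M X \<and> integrable M (\<lambda>\<omega>. (X \<omega> - integral\<^sup>L M X)\<^sup>2)"

text \<open>If \<^term>\<open>I\<close> is empty this says that \<^term>\<open>Y\<close> is constant on \<^term>\<open>space M\<close>.\<close>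

definition measurable_function_of ::
    "'a measure \<Rightarrow> ('i \<Rightarrow> 'b measure) \<Rightarrow> ('i \<Rightarrow> 'a \<Rightarrow> 'b) \<Rightarrow> 'i set \<Rightarrow> ('a \<Rightarrow> real) \<Rightarrow> bool" where
  "measurable_function_of M N Z I Y \<longleftrightarrow>
     (\<exists>g \<in> borel_measurable (PiM I N). \<forall>\<omega>\<in>space M. Y \<omega> = g (\<lambda>i\<in>I. Z i \<omega>))"

end

theory Submission
  imports Defs
begin

text \<open>
  Two ideas carry the proof.

  The first is a martingale argument, which reduces the claim to functions on the vertex set. When
  \<open>Z\<^sub>1, \<dots>, Z\<^sub>m\<close> are averaged out one after the other, each covariance becomes a sum over \<open>i\<close> of
  expected products of the increments belonging to \<open>Z\<^sub>i\<close>, and each variance a sum of their expected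
  squares. The increment of \<open>X\<^sub>v\<close> at step \<open>i\<close> vanishes unless \<open>v \<in> W\<^sub>i\<close>. So it is enough to bound,
  outcome by outcome, the quadratic form \<open>\<Sum> f(u) f(v)\<close> over the edges for a function \<open>f\<close> supported on
  a single \<open>W\<^sub>i\<close>, and to take expectations. The martingale is unrolled as an induction on the number
  of coordinates of a product space (\<open>covariance_sum_bound_PiM\<close>), whose step is the law of total
  covariance (\<open>total_covariance\<close>). Independence enters only through the fact that the joint law of
  the \<open>Z\<^sub>i\<close> is a product measure.

  The second is a Cheeger inequality with Dirichlet boundary condition (\<open>edge_sum_bound\<close>): if every
  \<open>S \<subseteq> U\<close> has at least \<open>h |S|\<close> boundary edges and \<open>f\<close> vanishes outside \<open>U\<close>, then the quadratic form
  is at most \<open>\<surd>(d\<^sup>2 - h\<^sup>2)/2 \<sqdot> \<Sum> f(v)\<^sup>2\<close> in absolute value. The coarea inequality for \<open>f\<^sup>2\<close> and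
  Cauchy-Schwarz give it. With \<open>h\<close> the isoperimetric minimum over all the \<open>W\<^sub>i\<close> one has
  \<open>\<beta> = (d + h)/2\<close>, and the constant is \<open>\<surd>(\<beta>(d - \<beta>))\<close>.
\<close>

section \<open>Sums over the edges of a regular graph\<close>

text \<open>Naming the two ends of each edge turns sums of symmetric functions over unordered edges into
  ordinary sums; which end is called \<open>p\<close> is arbitrary.\<close>

locale oriented_regular_graph =
  fixes V :: "'v set" and E :: "'v set set" and d :: nat and p q :: "'v set \<Rightarrow> 'v"
  assumes finite_V: "finite V"
    and regular: "regular_graph d V E"
    and ends: "e \<in> E \<Longrightarrow> e = {p e, q e}"
    and ends_distinct: "e \<in> E \<Longrightarrow> p e \<noteq> q e"
begin

lemma edge_subset: "e \<in> E \<Longrightarrow> e \<subseteq> V"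
  using regular by (auto simp: regular_graph_def simple_graph_def)

lemma finite_E: "finite E"
  using finite_V edge_subset by (meson PowI finite_Pow_iff finite_subset subsetI)

lemma ends_in_V: "e \<in> E \<Longrightarrow> p e \<in> V" "e \<in> E \<Longrightarrow> q e \<in> V"
  using ends edge_subset by blast+

lemma degree_sum: "(\<Sum>e\<in>E. a (p e) + a (q e)) = real d * (\<Sum>v\<in>V. a v)" for a :: "'v \<Rightarrow> real"
proof -
  have "(\<Sum>e\<in>E. a (p e) + a (q e)) = (\<Sum>e\<in>E. \<Sum>v | v \<in> V \<and> v \<in> e. a v)"
  proof (rule sum.cong)
    fix e assume e: "e \<in> E"
    then have "{v. v \<in> V \<and> v \<in> e} = {p e, q e}"
      using ends[OF e] edge_subset[OF e] by blast
    then show "a (p e) + a (q e) = (\<Sum>v | v \<in> V \<and> v \<in> e. a v)"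
      using ends_distinct[OF e] by simp
  qed simp
  also have "\<dots> = (\<Sum>v\<in>V. \<Sum>e | e \<in> E \<and> v \<in> e. a v)"
    by (rule sum.swap_restrict[OF finite_E finite_V])
  also have "\<dots> = (\<Sum>v\<in>V. real d * a v)"
    using regular by (intro sum.cong) (auto simp: regular_graph_def)
  finally show ?thesis by (simp add: sum_distrib_left)
qed

lemma edge_boundary_iff:
  assumes "e \<in> E"
  shows "e \<in> edge_boundary E S \<longleftrightarrow> (p e \<in> S) \<noteq> (q e \<in> S)"
proof -
  have "card ({p e, q e} \<inter> S) = 1 \<longleftrightarrow> (p e \<in> S) \<noteq> (q e \<in> S)"
    using ends_distinct[OF assms] by (cases "p e \<in> S"; cases "q e \<in> S") auto
  then show ?thesis
    using ends[OF assms] assms by (simp add: edge_boundary_def)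
qed

text \<open>A discrete coarea inequality. A nonnegative function is a positive combination of indicators
  of its superlevel sets, and on each edge the differences of these indicators have the same sign.
  The induction on the size of the support peels off the largest superlevel set, weighted by the
  least positive value.\<close>

lemma coarea:
  fixes a :: "'v \<Rightarrow> real"
  assumes "U \<subseteq> V"
    and iso: "\<And>S. S \<subseteq> U \<Longrightarrow> h * real (card S) \<le> real (card (edge_boundary E S))"
    and "\<And>v. v \<in> V \<Longrightarrow> 0 \<le> a v"
    and "\<And>v. v \<in> V - U \<Longrightarrow> a v = 0"
  shows "h * (\<Sum>v\<in>V. a v) \<le> (\<Sum>e\<in>E. \<bar>a (p e) - a (q e)\<bar>)"
  using assms(3,4)
proof (induction "card {v \<in> V. 0 < a v}" arbitrary: a rule: less_induct)
  case less
  define S where "S = {v \<in> V. 0 < a v}"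
  have finS: "finite S" and SV: "S \<subseteq> V"
    using finite_V by (auto simp: S_def)
  have SU: "S \<subseteq> U"
    using less.prems(2) unfolding S_def by force
  have zero: "a v = 0" if "v \<in> V" "v \<notin> S" for v
    using that less.prems(1)[of v] by (auto simp: S_def)
  show ?case
  proof (cases "S = {}")
    case True
    then have "(\<Sum>v\<in>V. a v) = 0" using zero by (simp add: sum.neutral)
    then show ?thesis by (simp add: sum_nonneg)
  next
    case False
    define t where "t = Min (a ` S)"
    have "t \<in> a ` S" using False finS unfolding t_def by simp
    then obtain w where w: "w \<in> S" "a w = t" by blast
    have t_pos: "0 < t" using w by (auto simp: S_def)
    have t_le: "t \<le> a v" if "v \<in> S" for v
      using that finS by (simp add: t_def)
    define b where "b v = a v - (if v \<in> S then t else 0)" for v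
    have b_nonneg: "0 \<le> b v" if "v \<in> V" for v
      using t_le[of v] less.prems(1)[OF that] by (simp add: b_def)
    have b_outside: "b v = 0" if "v \<in> V - U" for v
      using that SU less.prems(2)[OF that] by (auto simp: b_def)
    have "{v \<in> V. 0 < b v} \<subset> S"
    proof
      show "{v \<in> V. 0 < b v} \<subseteq> S" by (auto simp: b_def S_def split: if_splits)
      have "w \<notin> {v \<in> V. 0 < b v}" using w by (simp add: b_def)
      then show "{v \<in> V. 0 < b v} \<noteq> S" using w by blast
    qed
    then have "card {v \<in> V. 0 < b v} < card {v \<in> V. 0 < a v}"
      using finS psubset_card_mono unfolding S_def by blast
    then have IH: "h * (\<Sum>v\<in>V. b v) \<le> (\<Sum>e\<in>E. \<bar>b (p e) - b (q e)\<bar>)"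
      using less.hyps[of b] b_nonneg b_outside by blast
    have "(\<Sum>v\<in>V. a v) = (\<Sum>v\<in>V. b v) + (\<Sum>v\<in>V. if v \<in> S then t else 0)"
      unfolding sum.distrib[symmetric] b_def by (intro sum.cong) auto
    also have "(\<Sum>v\<in>V. if v \<in> S then t else 0) = t * real (card S)"
      using finite_V SV by (simp add: sum.If_cases Int_absorb1)
    finally have sum_a: "(\<Sum>v\<in>V. a v) = (\<Sum>v\<in>V. b v) + t * real (card S)" .
    have "(\<Sum>e\<in>E. \<bar>a (p e) - a (q e)\<bar>)
        = (\<Sum>e\<in>E. \<bar>b (p e) - b (q e)\<bar> + (if e \<in> edge_boundary E S then t else 0))"
    proof (rule sum.cong)
      fix e assume e: "e \<in> E"
      show "\<bar>a (p e) - a (q e)\<bar>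
          = \<bar>b (p e) - b (q e)\<bar> + (if e \<in> edge_boundary E S then t else 0)"
        using t_le[of "p e"] t_le[of "q e"] zero[of "p e"] zero[of "q e"] ends_in_V[OF e] t_pos
        unfolding edge_boundary_iff[OF e] b_def
        by (cases "p e \<in> S"; cases "q e \<in> S") auto
    qed simp
    also have "\<dots> = (\<Sum>e\<in>E. \<bar>b (p e) - b (q e)\<bar>) + t * real (card (edge_boundary E S))"
    proof -
      have "E \<inter> edge_boundary E S = edge_boundary E S" by (auto simp: edge_boundary_def)
      then show ?thesis using finite_E by (simp add: sum.distrib sum.If_cases)
    qed
    finally have sum_E: "(\<Sum>e\<in>E. \<bar>a (p e) - a (q e)\<bar>)
        = (\<Sum>e\<in>E. \<bar>b (p e) - b (q e)\<bar>) + t * real (card (edge_boundary E S))" .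
    have "t * (h * real (card S)) \<le> t * real (card (edge_boundary E S))"
      using iso[OF SU] t_pos by simp
    then show ?thesis
      unfolding sum_a sum_E using IH by (simp add: algebra_simps)
  qed
qed

text \<open>The Cheeger-type argument: the coarea inequality is applied to \<open>f\<^sup>2\<close>, and
  \<open>\<bar>f(u)\<^sup>2 - f(v)\<^sup>2\<bar> = \<bar>f(u) - f(v)\<bar> \<sqdot> \<bar>f(u) + f(v)\<bar>\<close> is split by Cauchy-Schwarz. By regularity,
  the two resulting sums of squares are \<open>d F - 2 A\<close> and \<open>d F + 2 A\<close>, where \<open>F\<close> is the sum of the
  \<open>f(v)\<^sup>2\<close> and \<open>A\<close> is the edge sum to be bounded; their product \<open>d\<^sup>2 F\<^sup>2 - 4 A\<^sup>2\<close> bounds \<open>A\<close> from both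
  sides at once.\<close>

lemma edge_sum_bound:
  fixes f :: "'v \<Rightarrow> real"
  assumes "U \<subseteq> V" "0 \<le> h"
    and iso: "\<And>S. S \<subseteq> U \<Longrightarrow> h * real (card S) \<le> real (card (edge_boundary E S))"
    and supp: "\<And>v. v \<in> V - U \<Longrightarrow> f v = 0"
  shows "\<bar>\<Sum>e\<in>E. f (p e) * f (q e)\<bar> \<le> sqrt ((real d)\<^sup>2 - h\<^sup>2) / 2 * (\<Sum>v\<in>V. (f v)\<^sup>2)"
proof -
  define F where "F = (\<Sum>v\<in>V. (f v)\<^sup>2)"
  define A where "A = (\<Sum>e\<in>E. f (p e) * f (q e))"
  have F_nonneg: "0 \<le> F" by (simp add: F_def sum_nonneg)
  have deg: "(\<Sum>e\<in>E. (f (p e))\<^sup>2 + (f (q e))\<^sup>2) = real d * F"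
    unfolding F_def by (rule degree_sum)
  have minus: "(\<Sum>e\<in>E. \<bar>f (p e) - f (q e)\<bar>\<^sup>2) = real d * F - 2 * A"
    unfolding deg[symmetric] A_def sum_distrib_left sum_subtractf[symmetric]
    by (intro sum.cong) (auto simp: power2_diff)
  have plus: "(\<Sum>e\<in>E. \<bar>f (p e) + f (q e)\<bar>\<^sup>2) = real d * F + 2 * A"
    unfolding deg[symmetric] A_def sum_distrib_left sum.distrib[symmetric]
    by (intro sum.cong) (auto simp: power2_sum)
  have "h * F \<le> (\<Sum>e\<in>E. \<bar>(f (p e))\<^sup>2 - (f (q e))\<^sup>2\<bar>)"
    unfolding F_def using assms by (intro coarea[where U = U]) auto
  also have "\<dots> = (\<Sum>e\<in>E. \<bar>f (p e) - f (q e)\<bar> * \<bar>f (p e) + f (q e)\<bar>)"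
    by (intro sum.cong) (auto simp: abs_mult[symmetric] power2_eq_square algebra_simps)
  finally have "(h * F)\<^sup>2 \<le> (\<Sum>e\<in>E. \<bar>f (p e) - f (q e)\<bar> * \<bar>f (p e) + f (q e)\<bar>)\<^sup>2"
    using assms(2) F_nonneg by (intro power_mono) auto
  also have "\<dots> \<le> (real d * F - 2 * A) * (real d * F + 2 * A)"
    unfolding minus[symmetric] plus[symmetric] by (rule Cauchy_Schwarz_ineq_sum)
  finally have "(2 * A)\<^sup>2 \<le> ((real d)\<^sup>2 - h\<^sup>2) * F\<^sup>2"
    by (simp add: power2_eq_square algebra_simps)
  then have "\<bar>2 * A\<bar> \<le> sqrt (((real d)\<^sup>2 - h\<^sup>2) * F\<^sup>2)"
    by (intro real_le_rsqrt) (simp only: power2_abs)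
  also have "\<dots> = sqrt ((real d)\<^sup>2 - h\<^sup>2) * F"
    using F_nonneg by (simp add: real_sqrt_mult)
  finally show ?thesis by (simp add: A_def F_def)
qed

end

section \<open>Square integrable random variables\<close>

definition square_int :: "'a measure \<Rightarrow> ('a \<Rightarrow> real) \<Rightarrow> bool" where
  "square_int M f \<longleftrightarrow> f \<in> borel_measurable M \<and> integrable M (\<lambda>x. (f x)\<^sup>2)"

lemma square_int_mult:
  assumes "square_int M f" "square_int M g"
  shows "integrable M (\<lambda>x. f x * g x)"
proof (rule Bochner_Integration.integrable_bound)
  show "integrable M (\<lambda>x. (f x)\<^sup>2 + (g x)\<^sup>2)"
    using assms by (simp add: square_int_def)
  show "(\<lambda>x. f x * g x) \<in> borel_measurable M"
    using assms by (simp add: square_int_def borel_measurable_times)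
  have "\<bar>a * b\<bar> \<le> a\<^sup>2 + b\<^sup>2" for a b :: real
  proof -
    have "2 * \<bar>a * b\<bar> \<le> a\<^sup>2 + b\<^sup>2"
      using sum_squares_bound[of "\<bar>a\<bar>" "\<bar>b\<bar>"] by (simp add: abs_mult mult.assoc)
    then show ?thesis using abs_ge_zero[of "a * b"] by linarith
  qed
  then show "AE x in M. norm (f x * g x) \<le> norm ((f x)\<^sup>2 + (g x)\<^sup>2)"
    by simp
qed

context prob_space
begin

lemma square_int_integrable: "square_int M f \<Longrightarrow> integrable M f"
  using square_integrable_imp_integrable by (auto simp: square_int_def)

lemma square_int_centered:
  assumes "square_int M f"
  shows "square_int M (\<lambda>x. f x - c)"
proof -
  have "integrable M (\<lambda>x. (f x)\<^sup>2 + c\<^sup>2 - 2 * f x * c)"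
    using assms square_int_integrable[OF assms]
    by (intro Bochner_Integration.integrable_diff Bochner_Integration.integrable_add
        integrable_mult_left integrable_mult_right integrable_const) (simp_all add: square_int_def)
  then show ?thesis
    using assms by (simp add: square_int_def power2_diff borel_measurable_diff)
qed

lemma finite_variance_imp_square_int:
  assumes "finite_variance M f"
  shows "square_int M f"
proof -
  have f: "integrable M f" and g: "integrable M (\<lambda>x. (f x - expectation f)\<^sup>2)"
    using assms by (auto simp: finite_variance_def)
  have "integrable M (\<lambda>x. (f x - expectation f)\<^sup>2 + (2 * expectation f * f x - (expectation f)\<^sup>2))"
    using f g by simp
  also have "(\<lambda>x. (f x - expectation f)\<^sup>2 + (2 * expectation f * f x - (expectation f)\<^sup>2))
      = (\<lambda>x. (f x)\<^sup>2)"
    by (simp add: power2_diff fun_eq_iff)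
  finally show ?thesis using f by (simp add: square_int_def borel_measurable_integrable)
qed

lemma covariance_eq:
  assumes f: "square_int M f" and g: "square_int M g"
  shows "covariance M f g = expectation (\<lambda>x. f x * g x) - expectation f * expectation g"
proof -
  note [simp] = square_int_integrable[OF f] square_int_integrable[OF g] square_int_mult[OF f g]
  have "covariance M f g = expectation (\<lambda>x. f x * g x - expectation g * f x
      - expectation f * g x + expectation f * expectation g)"
    unfolding covariance_def by (intro Bochner_Integration.integral_cong) (auto simp: algebra_simps)
  then show ?thesis by (simp add: prob_space)
qed

end

lemma covariance_self_nonneg: "0 \<le> covariance M f f"
  unfolding covariance_def by (rule Bochner_Integration.integral_nonneg) simp

text \<open>The case of a single source of randomness: centering turns the variables that are constant into
  zero, so that the graph inequality applies to the centered values at each point of the space.\<close>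

lemma (in oriented_regular_graph) covariance_sum_bound_single:
  fixes f :: "'v \<Rightarrow> 'a \<Rightarrow> real"
  assumes "prob_space P" "U \<subseteq> V" "0 \<le> h"
    and iso: "\<And>S. S \<subseteq> U \<Longrightarrow> h * real (card S) \<le> real (card (edge_boundary E S))"
    and f: "\<And>v. v \<in> V \<Longrightarrow> square_int P (f v)"
    and const: "\<And>v x. v \<in> V - U \<Longrightarrow> x \<in> space P \<Longrightarrow> f v x = c v"
  shows "\<bar>\<Sum>e\<in>E. covariance P (f (p e)) (f (q e))\<bar>
    \<le> sqrt ((real d)\<^sup>2 - h\<^sup>2) / 2 * (\<Sum>v\<in>V. covariance P (f v) (f v))"
proof -
  interpret P: prob_space P by fact
  let ?K = "sqrt ((real d)\<^sup>2 - h\<^sup>2) / 2"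
  define g where "g v x = f v x - P.expectation (f v)" for v x
  have g: "square_int P (g v)" if "v \<in> V" for v
    unfolding g_def by (rule P.square_int_centered[OF f[OF that]])
  have int[simp]: "integrable P (\<lambda>x. g u x * g v x)" if "u \<in> V" "v \<in> V" for u v
    using square_int_mult[OF g g] that .
  have int_E[simp]: "integrable P (\<lambda>x. \<Sum>e\<in>E. g (p e) x * g (q e) x)"
    by (intro Bochner_Integration.integrable_sum int ends_in_V)
  have cov: "covariance P (f u) (f v) = P.expectation (\<lambda>x. g u x * g v x)" for u v
    by (simp add: covariance_def g_def)
  have g0: "g v x = 0" if v: "v \<in> V - U" and x: "x \<in> space P" for v x
  proof -
    have "P.expectation (f v) = P.expectation (\<lambda>_. c v)"
      using const[OF v] by (intro Bochner_Integration.integral_cong) auto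
    then show ?thesis using const[OF v x] by (simp add: g_def P.prob_space)
  qed
  have "\<bar>\<Sum>e\<in>E. covariance P (f (p e)) (f (q e))\<bar>
      = \<bar>P.expectation (\<lambda>x. \<Sum>e\<in>E. g (p e) x * g (q e) x)\<bar>"
    unfolding cov using int ends_in_V by (subst Bochner_Integration.integral_sum) auto
  also have "\<dots> \<le> P.expectation (\<lambda>x. \<bar>\<Sum>e\<in>E. g (p e) x * g (q e) x\<bar>)"
    by (rule integral_abs_bound)
  also have "\<dots> \<le> P.expectation (\<lambda>x. ?K * (\<Sum>v\<in>V. g v x * g v x))"
  proof (rule integral_mono)
    show "integrable P (\<lambda>x. \<bar>\<Sum>e\<in>E. g (p e) x * g (q e) x\<bar>)" using int_E by simp
    show "integrable P (\<lambda>x. ?K * (\<Sum>v\<in>V. g v x * g v x))" by simp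
    fix x assume x: "x \<in> space P"
    show "\<bar>\<Sum>e\<in>E. g (p e) x * g (q e) x\<bar> \<le> ?K * (\<Sum>v\<in>V. g v x * g v x)"
      using edge_sum_bound[OF \<open>U \<subseteq> V\<close> \<open>0 \<le> h\<close> iso, of "\<lambda>v. g v x"] g0[OF _ x]
      by (simp add: power2_eq_square)
  qed
  also have "\<dots> = ?K * (\<Sum>v\<in>V. covariance P (f v) (f v))"
    unfolding cov by (subst Bochner_Integration.integral_mult_right_zero)
      (simp add: Bochner_Integration.integral_sum)
  finally show ?thesis .
qed

section \<open>Averaging out one coordinate\<close>

context pair_prob_space
begin

lemma square_int_slice:
  assumes "square_int (M1 \<Otimes>\<^sub>M M2) F"
  shows "AE y in M2. square_int M1 (\<lambda>x. F (x, y))"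
proof -
  have [measurable]: "F \<in> borel_measurable (M1 \<Otimes>\<^sub>M M2)"
    using assms by (simp add: square_int_def)
  have "AE y in M2. integrable M1 (\<lambda>x. (F (x, y))\<^sup>2)"
    using assms by (intro AE_integrable_snd) (simp add: square_int_def case_prod_unfold)
  moreover have "(\<lambda>x. F (x, y)) \<in> borel_measurable M1" if "y \<in> space M2" for y
    using that by measurable
  ultimately show ?thesis by (auto simp: square_int_def)
qed

text \<open>Averaging preserves square integrability because the conditional variance is nonnegative.\<close>

lemma square_int_average:
  assumes F: "square_int (M1 \<Otimes>\<^sub>M M2) F"
  shows "square_int M2 (\<lambda>y. \<integral>x. F (x, y) \<partial>M1)"
proof -
  have [measurable]: "F \<in> borel_measurable (M1 \<Otimes>\<^sub>M M2)"
    using F by (simp add: square_int_def)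
  have meas: "(\<lambda>y. \<integral>x. F (x, y) \<partial>M1) \<in> borel_measurable M2"
    by measurable
  have "integrable M2 (\<lambda>y. (\<integral>x. F (x, y) \<partial>M1)\<^sup>2)"
  proof (rule Bochner_Integration.integrable_bound)
    show "integrable M2 (\<lambda>y. \<integral>x. (F (x, y))\<^sup>2 \<partial>M1)"
      using F by (intro integrable_snd) (simp add: square_int_def case_prod_unfold)
    show "(\<lambda>y. (\<integral>x. F (x, y) \<partial>M1)\<^sup>2) \<in> borel_measurable M2" using meas by simp
    show "AE y in M2. norm ((\<integral>x. F (x, y) \<partial>M1)\<^sup>2) \<le> norm (\<integral>x. (F (x, y))\<^sup>2 \<partial>M1)"
      using square_int_slice[OF F]
    proof eventually_elim
      case (elim y)
      from M1.covariance_eq[OF elim elim] covariance_self_nonneg[of M1 "\<lambda>x. F (x, y)"]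
      show ?case by (simp add: power2_eq_square)
    qed
  qed
  with meas show ?thesis by (simp add: square_int_def)
qed

text \<open>The law of total covariance, conditioning on the second coordinate.\<close>

lemma
  assumes F: "square_int (M1 \<Otimes>\<^sub>M M2) F" and G: "square_int (M1 \<Otimes>\<^sub>M M2) G"
  shows integrable_conditional_covariance:
      "integrable M2 (\<lambda>y. covariance M1 (\<lambda>x. F (x, y)) (\<lambda>x. G (x, y)))"
    and total_covariance:
      "covariance (M1 \<Otimes>\<^sub>M M2) F G
        = (\<integral>y. covariance M1 (\<lambda>x. F (x, y)) (\<lambda>x. G (x, y)) \<partial>M2)
          + covariance M2 (\<lambda>y. \<integral>x. F (x, y) \<partial>M1) (\<lambda>y. \<integral>x. G (x, y) \<partial>M1)"
proof -
  have [measurable]: "F \<in> borel_measurable (M1 \<Otimes>\<^sub>M M2)" "G \<in> borel_measurable (M1 \<Otimes>\<^sub>M M2)"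
    using F G by (auto simp: square_int_def)
  let ?f = "\<lambda>y. \<integral>x. F (x, y) \<partial>M1" and ?g = "\<lambda>y. \<integral>x. G (x, y) \<partial>M1"
  let ?r = "\<lambda>y. \<integral>x. F (x, y) * G (x, y) \<partial>M1"
  let ?c = "\<lambda>y. covariance M1 (\<lambda>x. F (x, y)) (\<lambda>x. G (x, y))"
  note f = square_int_average[OF F] and g = square_int_average[OF G]
  have fg: "integrable M2 (\<lambda>y. ?f y * ?g y)" using f g by (rule square_int_mult)
  have FG: "integrable (M1 \<Otimes>\<^sub>M M2) (\<lambda>z. F z * G z)" using F G by (rule square_int_mult)
  then have r: "integrable M2 ?r" by (intro integrable_snd) (simp add: case_prod_unfold)
  have eq: "AE y in M2. ?c y = ?r y - ?f y * ?g y"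
    using square_int_slice[OF F] square_int_slice[OF G]
    by eventually_elim (rule M1.covariance_eq)
  have meas: "?c \<in> borel_measurable M2" unfolding covariance_def by measurable
  show "integrable M2 ?c"
    using r fg integrable_cong_AE[OF meas _ eq] by simp
  have "integral\<^sup>L M2 ?c = (\<integral>y. ?r y - ?f y * ?g y \<partial>M2)"
    using meas r fg eq by (intro integral_cong_AE) auto
  also have "\<dots> = (\<integral>y. ?r y \<partial>M2) - (\<integral>y. ?f y * ?g y \<partial>M2)"
    using r fg by simp
  also have "(\<integral>y. ?r y \<partial>M2) = (\<integral>z. F z * G z \<partial>(M1 \<Otimes>\<^sub>M M2))"
    using integral_snd[of "\<lambda>x y. F (x, y) * G (x, y)"] FG by (simp add: case_prod_unfold)
  finally have "integral\<^sup>L M2 ?c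
      = (\<integral>z. F z * G z \<partial>(M1 \<Otimes>\<^sub>M M2)) - (\<integral>y. ?f y * ?g y \<partial>M2)" .
  moreover have "(\<integral>y. ?f y \<partial>M2) = (\<integral>z. F z \<partial>(M1 \<Otimes>\<^sub>M M2))"
    using integral_snd[of "\<lambda>x y. F (x, y)"] P.square_int_integrable[OF F] by (simp add: case_prod_unfold)
  moreover have "(\<integral>y. ?g y \<partial>M2) = (\<integral>z. G z \<partial>(M1 \<Otimes>\<^sub>M M2))"
    using integral_snd[of "\<lambda>x y. G (x, y)"] P.square_int_integrable[OF G] by (simp add: case_prod_unfold)
  ultimately show "covariance (M1 \<Otimes>\<^sub>M M2) F G = integral\<^sup>L M2 ?c + covariance M2 ?f ?g"
    using P.covariance_eq[OF F G] M2.covariance_eq[OF f g] by simp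
qed

end

lemma covariance_distr:
  assumes [measurable]: "T \<in> measurable M N" "f \<in> borel_measurable N" "g \<in> borel_measurable N"
  shows "covariance (distr M N T) f g = covariance M (\<lambda>x. f (T x)) (\<lambda>x. g (T x))"
  unfolding covariance_def by (simp add: integral_distr)

lemma square_int_distr:
  assumes [measurable]: "T \<in> measurable M N" "f \<in> borel_measurable N"
  shows "square_int (distr M N T) f \<longleftrightarrow> square_int M (\<lambda>x. f (T x))"
  by (simp add: square_int_def integrable_distr_eq)

section \<open>The bound for functions on a product space\<close>

text \<open>Induction over the coordinates. Conditionally on the coordinates in \<open>J\<close>, only coordinate \<open>i\<close> is
  random, and \<open>f v\<close> is conditionally constant unless \<open>v \<in> W i\<close>; so the expected conditional covariances
  are controlled by the isoperimetry of \<open>W i\<close>. The conditional expectations again satisfy the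
  hypotheses, over \<open>J\<close>. Both sides of the inequality add up by the law of total covariance.\<close>

lemma (in oriented_regular_graph) covariance_sum_bound_PiM:
  fixes f :: "'v \<Rightarrow> ('i \<Rightarrow> 'b) \<Rightarrow> real" and W :: "'i \<Rightarrow> 'v set"
  assumes "finite I" "0 \<le> h"
    and prob: "\<And>i. i \<in> I \<Longrightarrow> prob_space (P i)"
    and WV: "\<And>i. i \<in> I \<Longrightarrow> W i \<subseteq> V"
    and iso: "\<And>i S. i \<in> I \<Longrightarrow> S \<subseteq> W i \<Longrightarrow> h * real (card S) \<le> real (card (edge_boundary E S))"
    and f: "\<And>v. v \<in> V \<Longrightarrow> square_int (PiM I P) (f v)"
    and dep: "\<And>v i x y. v \<in> V \<Longrightarrow> i \<in> I \<Longrightarrow> v \<notin> W i \<Longrightarrow> x \<in> space (PiM I P)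
                \<Longrightarrow> y \<in> space (P i) \<Longrightarrow> f v (x(i := y)) = f v x"
  shows "\<bar>\<Sum>e\<in>E. covariance (PiM I P) (f (p e)) (f (q e))\<bar>
    \<le> sqrt ((real d)\<^sup>2 - h\<^sup>2) / 2 * (\<Sum>v\<in>V. covariance (PiM I P) (f v) (f v))"
  using assms(1) prob WV iso f dep
proof (induction I arbitrary: f rule: finite_induct)
  case empty
  \<comment> \<open>The empty product is a one-point space, where every covariance is zero.\<close>
  have cov: "covariance (PiM {} P) F G = 0" for F G :: "('i \<Rightarrow> 'b) \<Rightarrow> real"
  proof -
    interpret prob_space "PiM {} P" by (rule prob_space_PiM) simp
    have "expectation F = expectation (\<lambda>_. F (\<lambda>_. undefined))"
      by (intro Bochner_Integration.integral_cong) (auto simp: space_PiM)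
    then have "expectation F = F (\<lambda>_. undefined)" by (simp add: prob_space)
    then have "covariance (PiM {} P) F G = expectation (\<lambda>_. 0)"
      unfolding covariance_def
      by (intro Bochner_Integration.integral_cong) (auto simp: space_PiM)
    then show ?thesis by simp
  qed
  show ?case by (simp add: cov)
next
  case (insert i J)
  let ?K = "sqrt ((real d)\<^sup>2 - h\<^sup>2) / 2"
  let ?Q = "PiM J P" and ?T = "\<lambda>(y, x). x(i := y)"
  interpret Pi: prob_space "P i" using insert.prems(1) by simp
  interpret Q: prob_space ?Q using insert.prems(1) by (intro prob_space_PiM) simp
  interpret PQ: pair_prob_space "P i" ?Q ..
  have T[measurable]: "?T \<in> measurable (P i \<Otimes>\<^sub>M ?Q) (PiM (insert i J) P)"
    by measurable
  have distr: "PiM (insert i J) P = distr (P i \<Otimes>\<^sub>M ?Q) (PiM (insert i J) P) ?T"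
    using insert.prems(1) by (intro distr_pair_PiM_eq_PiM[symmetric]) auto
  have meas: "f v \<in> borel_measurable (PiM (insert i J) P)" if "v \<in> V" for v
    using insert.prems(4)[OF that] by (simp add: square_int_def)
  define F where "F v z = f v (?T z)" for v z
  have F: "square_int (P i \<Otimes>\<^sub>M ?Q) (F v)" if "v \<in> V" for v
    using insert.prems(4)[OF that] square_int_distr[OF T meas[OF that]] distr
    unfolding F_def by simp
  have cov: "covariance (PiM (insert i J) P) (f u) (f v) = covariance (P i \<Otimes>\<^sub>M ?Q) (F u) (F v)"
    if "u \<in> V" "v \<in> V" for u v
    using covariance_distr[OF T meas[OF that(1)] meas[OF that(2)]] distr unfolding F_def by simp
  define g where "g v x = (\<integral>y. F v (y, x) \<partial>P i)" for v x
  define c where "c u v x = covariance (P i) (\<lambda>y. F u (y, x)) (\<lambda>y. F v (y, x))" for u v x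
  have c_int[simp]: "integrable ?Q (c u v)" if "u \<in> V" "v \<in> V" for u v
    unfolding c_def by (intro PQ.integrable_conditional_covariance F that)
  have total: "covariance (PiM (insert i J) P) (f u) (f v)
      = integral\<^sup>L ?Q (c u v) + covariance ?Q (g u) (g v)" if "u \<in> V" "v \<in> V" for u v
    unfolding c_def g_def cov[OF that] by (intro PQ.total_covariance F that)
  have in_space: "x(i := y) \<in> space (PiM (insert i J) P)"
    if "x \<in> space ?Q" "y \<in> space (P i)" for x y
    using measurable_space[OF T, of "(y, x)"] that by (simp add: space_pair_measure)

  have averaged: "\<bar>\<Sum>e\<in>E. covariance ?Q (g (p e)) (g (q e))\<bar>
      \<le> ?K * (\<Sum>v\<in>V. covariance ?Q (g v) (g v))"
  proof (rule insert.IH)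
    show "h * real (card S) \<le> real (card (edge_boundary E S))" if "j \<in> J" "S \<subseteq> W j" for j S
      using insert.prems(3)[of j S] that by simp
    show "square_int ?Q (g v)" if "v \<in> V" for v
      unfolding g_def by (intro PQ.square_int_average F that)
    show "g v (x(j := z)) = g v x"
      if v: "v \<in> V" "j \<in> J" "v \<notin> W j" and x: "x \<in> space ?Q" and z: "z \<in> space (P j)" for v j x z
      unfolding g_def F_def
    proof (rule Bochner_Integration.integral_cong)
      fix y assume y: "y \<in> space (P i)"
      have "j \<noteq> i" using v insert.hyps by blast
      moreover have "f v (x(i := y, j := z)) = f v (x(i := y))"
        using v by (intro insert.prems(5) in_space x y z) auto
      ultimately show "f v (?T (y, x(j := z))) = f v (?T (y, x))"
        by (simp only: prod.case fun_upd_twist[OF \<open>j \<noteq> i\<close>])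
    qed simp
  qed (use insert.prems in auto)

  have "AE x in ?Q. \<forall>v\<in>V. square_int (P i) (\<lambda>y. F v (y, x))"
    by (intro AE_finite_allI[OF finite_V] PQ.square_int_slice F)
  then have slices: "AE x in ?Q. \<bar>\<Sum>e\<in>E. c (p e) (q e) x\<bar> \<le> ?K * (\<Sum>v\<in>V. c v v x)"
  proof (rule AE_mp, intro AE_I2 impI)
    fix x assume x: "x \<in> space ?Q" and sq: "\<forall>v\<in>V. square_int (P i) (\<lambda>y. F v (y, x))"
    obtain y0 where y0: "y0 \<in> space (P i)" using Pi.not_empty by blast
    show "\<bar>\<Sum>e\<in>E. c (p e) (q e) x\<bar> \<le> ?K * (\<Sum>v\<in>V. c v v x)"
      unfolding c_def
    proof (rule covariance_sum_bound_single[where U = "W i" and c = "\<lambda>v. F v (y0, x)"])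
      show "h * real (card S) \<le> real (card (edge_boundary E S))" if "S \<subseteq> W i" for S
        using insert.prems(3)[of i S] that by simp
      fix v y assume v: "v \<in> V - W i" and y: "y \<in> space (P i)"
      have "f v (x(i := y0, i := y)) = f v (x(i := y0))"
        using v y by (intro insert.prems(5) in_space x y0) auto
      then show "F v (y, x) = F v (y0, x)" by (simp only: F_def prod.case fun_upd_upd)
    qed (use insert.prems sq \<open>0 \<le> h\<close> Pi.prob_space_axioms in auto)
  qed
  have "\<bar>\<Sum>e\<in>E. integral\<^sup>L ?Q (c (p e) (q e))\<bar> = \<bar>Q.expectation (\<lambda>x. \<Sum>e\<in>E. c (p e) (q e) x)\<bar>"
    using ends_in_V by (subst Bochner_Integration.integral_sum) auto
  also have "\<dots> \<le> Q.expectation (\<lambda>x. \<bar>\<Sum>e\<in>E. c (p e) (q e) x\<bar>)"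
    by (rule integral_abs_bound)
  also have "\<dots> \<le> Q.expectation (\<lambda>x. ?K * (\<Sum>v\<in>V. c v v x))"
    using slices ends_in_V by (intro integral_mono_AE) auto
  also have "\<dots> = ?K * (\<Sum>v\<in>V. integral\<^sup>L ?Q (c v v))"
    by (subst Bochner_Integration.integral_mult_right_zero)
      (simp add: Bochner_Integration.integral_sum)
  finally have conditional: "\<bar>\<Sum>e\<in>E. integral\<^sup>L ?Q (c (p e) (q e))\<bar>
      \<le> ?K * (\<Sum>v\<in>V. integral\<^sup>L ?Q (c v v))" .

  have "(\<Sum>e\<in>E. covariance (PiM (insert i J) P) (f (p e)) (f (q e)))
      = (\<Sum>e\<in>E. integral\<^sup>L ?Q (c (p e) (q e))) + (\<Sum>e\<in>E. covariance ?Q (g (p e)) (g (q e)))"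
    unfolding sum.distrib[symmetric] by (intro sum.cong refl total ends_in_V)
  moreover have "(\<Sum>v\<in>V. covariance (PiM (insert i J) P) (f v) (f v))
      = (\<Sum>v\<in>V. integral\<^sup>L ?Q (c v v)) + (\<Sum>v\<in>V. covariance ?Q (g v) (g v))"
    unfolding sum.distrib[symmetric] by (intro sum.cong refl total)
  ultimately show ?case
    using averaged conditional by (simp only: distrib_left)
qed

section \<open>Independent random variables\<close>

lemma regular_graph_orient:
  assumes "finite V" "regular_graph d V E"
  obtains p q where "oriented_regular_graph V E d p q"
proof -
  have "\<exists>u v. e = {u, v} \<and> u \<noteq> v" if "e \<in> E" for e
    using assms(2) that by (auto simp: regular_graph_def simple_graph_def card_2_iff)
  then obtain p q where "\<And>e. e \<in> E \<Longrightarrow> e = {p e, q e} \<and> p e \<noteq> q e"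
    by metis
  with assms show ?thesis
    by (intro that[of p q] oriented_regular_graph.intro) auto
qed

text \<open>With \<open>h\<close> the isoperimetric minimum, \<open>\<beta>(d - \<beta>) = (d\<^sup>2 - h\<^sup>2)/4\<close>, which is the constant of the
  Cheeger-type bound.\<close>

lemma beta_isoperimetry:
  assumes "\<And>i. i \<in> {1..m} \<Longrightarrow> finite (W i)" "\<exists>i\<in>{1..m}. W i \<noteq> {}"
  obtains h where "0 \<le> h"
    and "\<And>i S. i \<in> {1..m} \<Longrightarrow> S \<subseteq> W i \<Longrightarrow> h * real (card S) \<le> real (card (edge_boundary E S))"
    and "sqrt (beta d E m W * (real d - beta d E m W)) = sqrt ((real d)\<^sup>2 - h\<^sup>2) / 2"
proof -
  let ?R = "{real (card (edge_boundary E U)) / real (card U) | i U.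
               i \<in> {1..m} \<and> U \<subseteq> W i \<and> U \<noteq> {}}"
  define h where "h = Min ?R"
  have "?R \<subseteq> (\<lambda>U. real (card (edge_boundary E U)) / real (card U)) ` (\<Union>i\<in>{1..m}. Pow (W i))"
    by blast
  then have fin: "finite ?R"
    using assms(1) by (elim finite_subset) auto
  have ne: "?R \<noteq> {}" using assms(2) by blast
  have "h \<in> ?R" unfolding h_def by (rule Min_in[OF fin ne])
  then have "0 \<le> h" by auto
  moreover have "h * real (card S) \<le> real (card (edge_boundary E S))"
    if i: "i \<in> {1..m}" and S: "S \<subseteq> W i" for i S
  proof (cases "S = {}")
    case False
    have "finite S" using assms(1)[OF i] S finite_subset by blast
    then have "0 < real (card S)" using False by (simp add: card_gt_0_iff)
    moreover have "h \<le> real (card (edge_boundary E S)) / real (card S)"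
      unfolding h_def using i S False by (intro Min_le[OF fin]) blast
    ultimately show ?thesis by (simp add: pos_le_divide_eq)
  qed simp
  moreover have "sqrt (beta d E m W * (real d - beta d E m W)) = sqrt ((real d)\<^sup>2 - h\<^sup>2) / 2"
  proof -
    have "beta d E m W = (real d + h) / 2" by (simp add: beta_def h_def)
    then have "beta d E m W * (real d - beta d E m W) = ((real d)\<^sup>2 - h\<^sup>2) / 4"
      by (simp only:) (simp add: field_simps power2_eq_square)
    then show ?thesis by (simp only: real_sqrt_divide real_sqrt_four)
  qed
  ultimately show ?thesis by (rule that)
qed

theorem theorem4p4:
  fixes V :: "'v set" and E :: "'v set set" and d m :: nat
    and M :: "'a measure"
    and N :: "nat \<Rightarrow> 'b measure" and Z :: "nat \<Rightarrow> 'a \<Rightarrow> 'b"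
    and W :: "nat \<Rightarrow> 'v set" and X :: "'v \<Rightarrow> 'a \<Rightarrow> real"
  assumes "finite V"
    and "regular_graph d V E"
    and "prob_space M"
    and "prob_space.indep_vars M N Z {1..m}"
    and "\<And>i. i \<in> {1..m} \<Longrightarrow> W i \<subseteq> V"
    and "\<exists>i\<in>{1..m}. W i \<noteq> {}"
    and "\<And>v. v \<in> V \<Longrightarrow> measurable_function_of M N Z {i \<in> {1..m}. v \<in> W i} (X v)"
    and "\<And>v. v \<in> V \<Longrightarrow> finite_variance M (X v)"
  shows "\<bar>\<Sum>e\<in>E. at_edge (\<lambda>u v. covariance M (X u) (X v)) e\<bar>
           \<le> sqrt (beta d E m W * (real d - beta d E m W))
              * (\<Sum>v\<in>V. prob_space.variance M (X v))"
proof -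
  interpret M: prob_space M by fact
  obtain p q where "oriented_regular_graph V E d p q"
    using regular_graph_orient assms(1,2) .
  then interpret oriented_regular_graph V E d p q .
  obtain h where h: "0 \<le> h"
    and iso: "\<And>i S. i \<in> {1..m} \<Longrightarrow> S \<subseteq> W i \<Longrightarrow> h * real (card S) \<le> real (card (edge_boundary E S))"
    and K: "sqrt (beta d E m W * (real d - beta d E m W)) = sqrt ((real d)\<^sup>2 - h\<^sup>2) / 2"
    using beta_isoperimetry[where m = m and W = W and E = E and d = d] assms(1,5,6) finite_subset
    by metis
  let ?I = "\<lambda>v. {i \<in> {1..m}. v \<in> W i}"
  have "\<forall>v\<in>V. \<exists>g. g \<in> borel_measurable (PiM (?I v) N)
      \<and> (\<forall>\<omega>\<in>space M. X v \<omega> = g (\<lambda>i\<in>?I v. Z i \<omega>))"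
    using assms(7) unfolding measurable_function_of_def by blast
  from bchoice[OF this] obtain g
    where g: "\<And>v. v \<in> V \<Longrightarrow> g v \<in> borel_measurable (PiM (?I v) N)"
    and Xg: "\<And>v \<omega>. v \<in> V \<Longrightarrow> \<omega> \<in> space M \<Longrightarrow> X v \<omega> = g v (\<lambda>i\<in>?I v. Z i \<omega>)"
    by blast
  define f where "f v x = g v (restrict x (?I v))" for v x
  define T where "T \<omega> = (\<lambda>i\<in>{1..m}. Z i \<omega>)" for \<omega>
  define P where "P i = distr M (N i) (Z i)" for i
  have rv: "Z i \<in> measurable M (N i)" if "i \<in> {1..m}" for i
    using assms(4) that by (auto simp: M.indep_vars_def)
  have T[measurable]: "T \<in> measurable M (PiM {1..m} N)"
    unfolding T_def using rv by (intro measurable_restrict)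
  have f_meas: "f v \<in> borel_measurable (PiM {1..m} N)" if "v \<in> V" for v
    unfolding f_def by (rule measurable_compose[OF measurable_restrict_subset g[OF that]]) auto
  have "{1..m} \<noteq> {}" using assms(6) by blast
  then have distr: "distr M (PiM {1..m} N) T = PiM {1..m} P"
    using M.indep_vars_iff_distr_eq_PiM'[where I = "{1..m}" and M' = N and X = Z] rv assms(4) by (simp add: T_def[abs_def] P_def[abs_def])
  have Xf: "X v \<omega> = f v (T \<omega>)" if "v \<in> V" "\<omega> \<in> space M" for v \<omega>
  proof -
    have "restrict (T \<omega>) (?I v) = (\<lambda>i\<in>?I v. Z i \<omega>)" by (auto simp: T_def)
    then show ?thesis using Xg[OF that] by (simp add: f_def)
  qed
  have cov: "covariance M (X u) (X v) = covariance (PiM {1..m} P) (f u) (f v)"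
    if uv: "u \<in> V" "v \<in> V" for u v
  proof -
    have "covariance M (X u) (X v) = covariance M (\<lambda>\<omega>. f u (T \<omega>)) (\<lambda>\<omega>. f v (T \<omega>))"
      using Xf[OF uv(1)] Xf[OF uv(2)]
      unfolding covariance_def by (simp cong: Bochner_Integration.integral_cong)
    then show ?thesis
      using covariance_distr[OF T f_meas[OF uv(1)] f_meas[OF uv(2)]] distr by simp
  qed
  have f_sq: "square_int (PiM {1..m} P) (f v)" if v: "v \<in> V" for v
  proof -
    have "square_int M (X v)" using M.finite_variance_imp_square_int assms(8) v .
    then have "square_int M (\<lambda>\<omega>. f v (T \<omega>))"
      unfolding square_int_def using Xf[OF v]
      by (simp cong: measurable_cong Bochner_Integration.integrable_cong)
    then show ?thesis using square_int_distr[OF T f_meas[OF v]] distr by simp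
  qed
  have "\<bar>\<Sum>e\<in>E. covariance (PiM {1..m} P) (f (p e)) (f (q e))\<bar>
      \<le> sqrt ((real d)\<^sup>2 - h\<^sup>2) / 2 * (\<Sum>v\<in>V. covariance (PiM {1..m} P) (f v) (f v))"
  proof (rule covariance_sum_bound_PiM[where W = W])
    show "prob_space (P i)" if "i \<in> {1..m}" for i
      unfolding P_def using rv[OF that] by (rule M.prob_space_distr)
    show "f v (x(i := y)) = f v x" if "v \<notin> W i" for v i x y
    proof -
      have "restrict (x(i := y)) (?I v) = restrict x (?I v)" using that by auto
      then show ?thesis by (simp add: f_def)
    qed
  qed (use h iso assms(5) f_sq in auto)
  moreover have "(\<Sum>e\<in>E. covariance (PiM {1..m} P) (f (p e)) (f (q e)))
      = (\<Sum>e\<in>E. at_edge (\<lambda>u v. covariance M (X u) (X v)) e)"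
  proof (rule sum.cong)
    fix e assume e: "e \<in> E"
    have "at_edge (\<lambda>u v. covariance M (X u) (X v)) {p e, q e} = covariance M (X (p e)) (X (q e))"
      by (rule at_edge_covariance)
    then show "covariance (PiM {1..m} P) (f (p e)) (f (q e))
        = at_edge (\<lambda>u v. covariance M (X u) (X v)) e"
      using cov ends_in_V[OF e] ends[OF e] by simp
  qed simp
  moreover have "(\<Sum>v\<in>V. covariance (PiM {1..m} P) (f v) (f v)) = (\<Sum>v\<in>V. M.variance (X v))"
    using cov by (intro sum.cong) (auto simp: covariance_def power2_eq_square)
  ultimately show ?thesis unfolding K by simp
qed

end
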